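(* Fix current beamformers $\{\underline{\mathbf{W}}_i\}$ and perform one round of the WMMSE algorithm for MIMO beamforming in the order $\mathbf{L}$, $\mathbf{M}$, $\mathbf{W}$: for $k=1,\dots,K$, $$\mathbf{L}_k=(\underline{\mathbf{F}}_k+\mathbf{H}_{k,k}\underline{\mathbf{W}}_k\underline{\mathbf{W}}_k^{\mathsf{H}}\mathbf{H}_{k,k}^{\mathsf{H}})^{-1}\mathbf{H}_{k,k}\underline{\mathbf{W}}_k,$$ $$\mathbf{M}_k=\Bigl(\sum_{j=1}^{K}\mathbf{L}_k^{\mathsf{H}}\mathbf{H}_{k,j}\underline{\mathbf{W}}_j\underline{\mathbf{W}}_j^{\mathsf{H}}\mathbf{H}_{k,j}^{\mathsf{H}}\mathbf{L}_k-\mathbf{L}_k^{\mathsf{H}}\mathbf{H}_{k,k}\underline{\mathbf{W}}_k-\underline{\mathbf{W}}_k^{\mathsf{H}}\mathbf{H}_{k,k}^{\mathsf{H}}\mathbf{L}_k+\sigma_k^2\mathbf{L}_k^{\mathsf{H}}\mathbf{L}_k+\mathbf{I}\Bigr)^{-1},$$ $$\mathbf{W}_k=\Bigl(\sum_{j=1}^{K}\omega_j\mathbf{H}_{j,k}^{\mathsf{H}}\mathbf{L}_j\mathbf{M}_j\mathbf{L}_j^{\mathsf{H}}\mathbf{H}_{j,k}+\mu_k\mathbf{I}\Bigr)^{\dagger}\omega_k\mathbf{H}_{k,k}^{\mathsf{H}}\mathbf{L}_k\mathbf{M}_k.$$ Then $\mathbf{M}_k=\mathbf{I}+\underline{\mathbf{W}}_k^{\mathsf{H}}\mathbf{H}_{k,k}^{\mathsf{H}}\underline{\mathbf{F}}_k^{-1}\mathbf{H}_{k,k}\underline{\mathbf{W}}_k$,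 and $\mathbf{L}_k\mathbf{M}_k\mathbf{L}_k^{\mathsf{H}}=\mathbf{A}_k$, $\mathbf{M}_k^{\mathsf{H}}\mathbf{L}_k^{\mathsf{H}}=\mathbf{B}_k$, where $\mathbf{B}_k=\underline{\mathbf{W}}_k^{\mathsf{H}}\mathbf{H}_{k,k}^{\mathsf{H}}\underline{\mathbf{F}}_k^{-1}$ and $\mathbf{A}_k=(\underline{\mathbf{F}}_k+\mathbf{H}_{k,k}\underline{\mathbf{W}}_k\underline{\mathbf{W}}_k^{\mathsf{H}}\mathbf{H}_{k,k}^{\mathsf{H}})^{-1}\mathbf{H}_{k,k}\underline{\mathbf{W}}_k\mathbf{B}_k$. Consequently the resulting beamformers $\{\mathbf{W}_k\}$ coincide with those produced from $\{\underline{\mathbf{W}}_i\}$ by the WSR-MM algorithm, $$\mathbf{W}_k=\Bigl(\sum_{j=1}^{K}\omega_j\mathbf{H}_{j,k}^{\mathsf{H}}\mathbf{A}_j\mathbf{H}_{j,k}+\mu_k\mathbf{I}\Bigr)^{\dagger}\omega_k\mathbf{H}_{k,k}^{\mathsf{H}}\mathbf{B}_k^{\mathsf{H}}.$$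
   Context: Setting: $K$ links; $\mathbf{H}_{i,j}\in\mathbb{C}^{M_i^{\mathsf r}\times M_j^{\mathsf t}}$ is the channel from transmitter $j$ to receiver $i$; $\mathbf{W}_k\in\mathbb{C}^{M_k^{\mathsf t}\times M_k^{\mathsf s}}$ is the beamformer of link $k$; $\sigma_k^2>0$ noise variances, $\omega_k>0$ weights, $P_k>0$ power budgets. $\underline{\mathbf{F}}_k=\sum_{j\ne k}\mathbf{H}_{k,j}\underline{\mathbf{W}}_j\underline{\mathbf{W}}_j^{\mathsf{H}}\mathbf{H}_{k,j}^{\mathsf{H}}+\sigma_k^2\mathbf{I}$. $(\cdot)^\dagger$ is the Moore–Penrose pseudo-inverse and $\|\cdot\|$ the Frobenius norm. In both algorithms, viewing the displayed formula for $\mathbf{W}_k$ as a function $\mathbf{W}_k(\mu_k)$ of $\mu_k$, the multiplier is chosen as $\mu_k=\min\{\mu_k\ge 0:\|\mathbf{W}_k(\mu_k)\|^2\le P_k\}$. *)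

theory Defs
  imports
    "Jordan_Normal_Form.Gauss_Jordan_Elimination"
    "Jordan_Normal_Form.Schur_Decomposition"
begin

notation mat_adjoint ("_\<^sup>H" [1000] 999)

text \<open>
  \<open>mat_inverse\<close> yields \<open>None\<close> on a singular matrix, so \<open>mat_inv\<close> is unspecified there.
\<close>
abbreviation mat_inv :: "complex mat \<Rightarrow> complex mat" where
  "mat_inv A \<equiv> the (mat_inverse A)"

abbreviation finsum_mat :: "nat \<Rightarrow> nat \<Rightarrow> ('i \<Rightarrow> complex mat) \<Rightarrow> 'i set \<Rightarrow> complex mat" where
  "finsum_mat nr nc f I \<equiv> finsum (module_mat TYPE(complex) nr nc) f I"

definition penrose_inverse :: "complex mat \<Rightarrow> complex mat \<Rightarrow> bool" where
  "penrose_inverse A X \<longleftrightarrow>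
     X \<in> carrier_mat (dim_col A) (dim_row A) \<and>
     A * X * A = A \<and>
     X * A * X = X \<and>
     (A * X)\<^sup>H = A * X \<and>
     (X * A)\<^sup>H = X * A"

definition pseudo_inverse :: "complex mat \<Rightarrow> complex mat" where
  "pseudo_inverse A = (THE X. penrose_inverse A X)"

definition frobenius_norm :: "complex mat \<Rightarrow> real" where
  "frobenius_norm A = sqrt (\<Sum>i<dim_row A. \<Sum>j<dim_col A. (cmod (A $$ (i, j)))\<^sup>2)"

text \<open>
  The minimum of \<open>{\<mu> \<ge> 0. \<parallel>V \<mu>\<parallel>\<^sup>2 \<le> p}\<close>, for a beamformer \<open>V\<close> given as a function of the
  multiplier and a power budget \<open>p\<close>; unspecified if the set has no minimum.
\<close>
definition power_multiplier :: "(real \<Rightarrow> complex mat) \<Rightarrow> real \<Rightarrow> real" where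
  "power_multiplier V p = (LEAST \<mu>. 0 \<le> \<mu> \<and> (frobenius_norm (V \<mu>))\<^sup>2 \<le> p)"

end

theory Submission
  imports Defs
begin

text \<open>
  With \<open>G = H\<^sub>k\<^sub>k W\<^sub>k\<close> and \<open>J = F + G G\<^sup>H\<close>, the receiver is \<open>L = J\<^sup>-\<^sup>1 G\<close>, and \<open>J L = G\<close> collapses
  the error matrix to \<open>E = I - G\<^sup>H L\<close>.  Put \<open>N = I + G\<^sup>H F\<^sup>-\<^sup>1 G\<close>.  From
  \<open>J F\<^sup>-\<^sup>1 G = G N\<close> one gets \<open>L N = F\<^sup>-\<^sup>1 G\<close>, hence \<open>E N = N - G\<^sup>H F\<^sup>-\<^sup>1 G = I\<close>, so \<open>M = N\<close>.
  The remaining identities are read off from \<open>L M = F\<^sup>-\<^sup>1 G = B\<^sup>H\<close>.  Both beamformer formulas then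
  agree as functions of the multiplier, whatever multiplier the power constraint selects.
\<close>

text \<open>Associativity conditioned on dimension equations has no free carrier sizes, so a
  simplifier call can rebracket long products of rectangular matrices from the dimensions
  alone.\<close>

lemma mult_assoc_mat_dim:
  fixes A B C :: "'a :: semiring_0 mat"
  assumes "dim_col A = dim_row B" "dim_col B = dim_row C"
  shows "A * B * C = A * (B * C)"
  by (rule assoc_mult_mat[of A "dim_row A" "dim_col A" B "dim_col B" C "dim_col C"])
    (use assms in auto)

section \<open>Algebra of the conjugate transpose\<close>

lemma dim_adjoint [simp]: "dim_row (A\<^sup>H) = dim_col A" "dim_col (A\<^sup>H) = dim_row A"
  by (auto simp: mat_adjoint_def)

lemma adjoint_carrier [simp]: "A\<^sup>H \<in> carrier_mat m n \<longleftrightarrow> A \<in> carrier_mat n m"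
  unfolding carrier_mat_def by auto

lemma index_adjoint [simp]:
  "i < dim_col A \<Longrightarrow> j < dim_row A \<Longrightarrow> A\<^sup>H $$ (i, j) = conjugate (A $$ (j, i))"
  by (simp add: mat_adjoint_def mat_of_rows_def)

lemma adjoint_adjoint [simp]: "(A\<^sup>H)\<^sup>H = (A :: 'a :: conjugatable_field mat)"
  by (rule eq_matI) auto

lemma adjoint_one [simp]: "(1\<^sub>m n)\<^sup>H = (1\<^sub>m n :: complex mat)"
  by (rule eq_matI) auto

lemma adjoint_add:
  assumes "A \<in> carrier_mat n m" "B \<in> carrier_mat n m"
  shows "(A + B)\<^sup>H = A\<^sup>H + (B :: 'a :: conjugatable_field mat)\<^sup>H"
  using assms by (intro eq_matI) (auto simp: conjugate_dist_add)

lemma adjoint_smult: "(a \<cdot>\<^sub>m A)\<^sup>H = conjugate a \<cdot>\<^sub>m (A :: 'a :: conjugatable_field mat)\<^sup>H"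
  by (intro eq_matI) (auto simp: conjugate_dist_mul)

lemma adjoint_mult:
  fixes A B :: "'a :: conjugatable_field mat"
  assumes "dim_col A = dim_row B"
  shows "(A * B)\<^sup>H = B\<^sup>H * A\<^sup>H"
  using assms
  by (intro eq_matI) (auto simp: scalar_prod_def sum_conjugate conjugate_dist_mul mult.commute)

section \<open>Hermitian forms and positive semidefinite matrices\<close>

lemma mult_mat_vec_cscalar_prod:
  fixes A :: "'a :: conjugatable_field mat"
  assumes "A \<in> carrier_mat n m" "w \<in> carrier_vec m" "v \<in> carrier_vec n"
  shows "(A *\<^sub>v w) \<bullet>c v = w \<bullet>c (A\<^sup>H *\<^sub>v v)"
proof -
  have "(A *\<^sub>v w) \<bullet>c v = (\<Sum>i<n. \<Sum>j<m. A $$ (i, j) * w $ j * conjugate (v $ i))"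
    using assms by (simp add: scalar_prod_def sum_distrib_right atLeast0LessThan)
  also have "\<dots> = (\<Sum>j<m. \<Sum>i<n. A $$ (i, j) * w $ j * conjugate (v $ i))"
    by (rule sum.swap)
  also have "\<dots> = w \<bullet>c (A\<^sup>H *\<^sub>v v)"
    using assms
    by (simp add: scalar_prod_def sum_distrib_left sum_conjugate conjugate_dist_mul
        atLeast0LessThan mult_ac)
  finally show ?thesis .
qed

text \<open>The order on complex numbers compares real parts and demands equal imaginary parts, so
  \<open>0 \<le>\<close> says that the form is real as well as nonnegative.\<close>

definition psd_mat :: "nat \<Rightarrow> complex mat \<Rightarrow> bool" where
  "psd_mat n S \<longleftrightarrow> S \<in> carrier_mat n n \<and> S\<^sup>H = S \<and> (\<forall>v\<in>carrier_vec n. 0 \<le> (S *\<^sub>v v) \<bullet>c v)"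

lemma psd_mat_zero: "psd_mat n (0\<^sub>m n n)"
proof -
  have "0\<^sub>m n n *\<^sub>v v = 0\<^sub>v n" if "v \<in> carrier_vec n" for v :: "complex vec"
    using that by (intro eq_vecI) auto
  moreover have "(0\<^sub>m n n)\<^sup>H = (0\<^sub>m n n :: complex mat)"
    by (rule eq_matI) auto
  ultimately show ?thesis by (simp add: psd_mat_def)
qed

lemma psd_mat_add:
  assumes "psd_mat n S" "psd_mat n T"
  shows "psd_mat n (S + T)"
  using assms
  by (auto simp: psd_mat_def adjoint_add add_mult_distrib_mat_vec
      add_scalar_prod_distrib[of _ n])

text \<open>Moving the left factor \<open>G\<close> across the inner product turns the form at v
  into the squared norm of G^H v.\<close>

lemma psd_mat_mult_adjoint:
  assumes "G \<in> carrier_mat n m"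
  shows "psd_mat n (G * G\<^sup>H)"
proof -
  have "0 \<le> ((G * G\<^sup>H) *\<^sub>v v) \<bullet>c v" if v: "v \<in> carrier_vec n" for v
  proof -
    have GHv: "G\<^sup>H *\<^sub>v v \<in> carrier_vec m"
      using assms v by (intro mult_mat_vec_carrier) auto
    have "((G * G\<^sup>H) *\<^sub>v v) \<bullet>c v = (G *\<^sub>v (G\<^sup>H *\<^sub>v v)) \<bullet>c v"
      using assms v by (subst assoc_mult_mat_vec) auto
    also have "\<dots> = (G\<^sup>H *\<^sub>v v) \<bullet>c (G\<^sup>H *\<^sub>v v)"
      by (rule mult_mat_vec_cscalar_prod[OF assms GHv v])
    finally show ?thesis
      by (simp add: conjugate_square_ge_0_vec)
  qed
  moreover have "(G * G\<^sup>H)\<^sup>H = G * G\<^sup>H"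
    by (subst adjoint_mult) auto
  moreover have "G * G\<^sup>H \<in> carrier_mat n n"
    using assms by auto
  ultimately show ?thesis
    unfolding psd_mat_def by blast
qed

section \<open>Finite sums of matrices\<close>

lemma abelian_monoid_module_mat: "abelian_monoid (module_mat TYPE(complex) nr nc)"
  by (rule abelian_group.axioms(1)[OF abelian_group_mat])

lemma finsum_mat_carrier:
  assumes "\<And>j. j \<in> I \<Longrightarrow> f j \<in> carrier_mat nr nc"
  shows "finsum_mat nr nc f I \<in> carrier_mat nr nc"
proof -
  have "f \<in> I \<rightarrow> carrier (module_mat TYPE(complex) nr nc)"
    using assms by (auto simp: module_mat_simps)
  from abelian_monoid.finsum_closed[OF abelian_monoid_module_mat this] show ?thesis
    by (simp add: module_mat_simps)
qed

lemma finsum_mat_empty: "finsum_mat nr nc f {} = 0\<^sub>m nr nc"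
  using abelian_monoid.finsum_empty[OF abelian_monoid_module_mat]
  by (simp add: module_mat_simps)

lemma finsum_mat_insert:
  assumes "finite I" "i \<notin> I" "\<And>j. j \<in> insert i I \<Longrightarrow> f j \<in> carrier_mat nr nc"
  shows "finsum_mat nr nc f (insert i I) = f i + finsum_mat nr nc f I"
  using abelian_monoid.finsum_insert[OF abelian_monoid_module_mat, of I i f nr nc] assms
  by (auto simp: module_mat_simps Pi_def)

lemma finsum_mat_cong:
  assumes "\<And>j. j \<in> I \<Longrightarrow> f j = g j" "\<And>j. j \<in> I \<Longrightarrow> g j \<in> carrier_mat nr nc"
  shows "finsum_mat nr nc f I = finsum_mat nr nc g I"
  using assms
  by (intro abelian_monoid.finsum_cong'[OF abelian_monoid_module_mat])
    (auto simp: module_mat_simps)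

text \<open>Meant for the interference covariance. The induction starts at the zero matrix, which is
  that covariance when there is only one link.\<close>

lemma psd_mat_finsum:
  assumes "finite I" "\<And>j. j \<in> I \<Longrightarrow> psd_mat n (f j)"
  shows "psd_mat n (finsum_mat n n f I)"
  using assms
proof (induction I)
  case empty
  then show ?case by (simp add: finsum_mat_empty psd_mat_zero)
next
  case (insert i I)
  then show ?case
    by (subst finsum_mat_insert) (auto simp: psd_mat_add, auto simp: psd_mat_def)
qed

text \<open>Distributivity on both sides, by induction on the index set. It pulls L^H and L out of
  the sum over transmitters in the error matrix.\<close>

lemma finsum_mat_sandwich:
  assumes "finite I" "\<And>j. j \<in> I \<Longrightarrow> f j \<in> carrier_mat n n"
    "A \<in> carrier_mat m n" "B \<in> carrier_mat n m"
  shows "finsum_mat m m (\<lambda>j. A * f j * B) I = A * finsum_mat n n f I * B"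
  using assms(1,2)
proof (induction I)
  case empty
  then show ?case using assms(3,4) by (simp add: finsum_mat_empty)
next
  case (insert i I)
  have S: "finsum_mat n n f I \<in> carrier_mat n n"
    using insert.prems by (intro finsum_mat_carrier) auto
  have "finsum_mat m m (\<lambda>j. A * f j * B) (insert i I)
      = A * f i * B + A * finsum_mat n n f I * B"
    using insert assms(3,4) by (subst finsum_mat_insert) auto
  also have "\<dots> = A * (f i + finsum_mat n n f I) * B"
    using S insert.prems[of i] assms(3,4)
    by (simp add: mult_add_distrib_mat[of _ m n] add_mult_distrib_mat[of _ m n] del: assoc_mult_mat)
  also have "\<dots> = A * finsum_mat n n f (insert i I) * B"
    using insert by (subst finsum_mat_insert) auto
  finally show ?case .
qed

section \<open>Existence, uniqueness and symmetry of inverses\<close>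

lemma mat_inv_eqI:
  assumes A: "A \<in> carrier_mat n n" and B: "B \<in> carrier_mat n n" and AB: "A * B = 1\<^sub>m n"
  shows "mat_inv A = B"
proof -
  have BA: "B * A = 1\<^sub>m n"
    by (rule mat_mult_left_right_inverse[OF A B AB])
  \<comment> \<open>Being a unit excludes the result \<open>None\<close>, for which
    \<open>mat_inv\<close> is unspecified. The inverse \<open>C\<close> so obtained is identified
    with \<open>B\<close> by evaluating C A B in two ways.\<close>
  have "A \<in> Units (ring_mat TYPE(complex) n ())"
    using A B AB BA by (auto simp: Units_def ring_mat_simps)
  then obtain C where C: "mat_inverse A = Some C"
    using mat_inverse(1)[OF A, where b = "()"] by (cases "mat_inverse A") auto
  have "C * (A * B) = C"
    using mat_inverse(2)[OF A C] by (auto simp: AB)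
  moreover have "C * (A * B) = B"
    using mat_inverse(2)[OF A C] A B by (auto simp flip: assoc_mult_mat)
  ultimately show ?thesis by (simp add: C)
qed

text \<open>A nonzero kernel vector v of \<open>J\<close> would give 0 = v^H S v + s |v|^2, whose
  right side is positive. So the determinant does not vanish. This covers both the
  noise-plus-interference covariance and the total received covariance.\<close>

lemma mat_inv_pos_def:
  assumes S: "psd_mat n S" and s: "s > 0"
  defines "J \<equiv> S + complex_of_real s \<cdot>\<^sub>m 1\<^sub>m n"
  shows "mat_inv J \<in> carrier_mat n n" "J * mat_inv J = 1\<^sub>m n" "mat_inv J * J = 1\<^sub>m n"
proof -
  have Sc: "S \<in> carrier_mat n n" and J: "J \<in> carrier_mat n n"
    using S by (auto simp: psd_mat_def J_def)
  have "det J \<noteq> 0"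
  proof
    assume "det J = 0"
    then obtain v where v: "v \<in> carrier_vec n" "v \<noteq> 0\<^sub>v n" and "J *\<^sub>v v = 0\<^sub>v n"
      using det_0_iff_vec_prod_zero[OF J] by blast
    then have "0 = (J *\<^sub>v v) \<bullet>c v"
      by simp
    also have "J *\<^sub>v v = S *\<^sub>v v + complex_of_real s \<cdot>\<^sub>v v"
    proof -
      have "(complex_of_real s \<cdot>\<^sub>m 1\<^sub>m n) *\<^sub>v v = complex_of_real s \<cdot>\<^sub>v v"
        using v by (intro eq_vecI) auto
      then show ?thesis
        using Sc v by (simp add: J_def add_mult_distrib_mat_vec[of _ n n])
    qed
    also have "\<dots> \<bullet>c v = (S *\<^sub>v v) \<bullet>c v + complex_of_real s * (v \<bullet>c v)"
      using Sc v by (simp add: add_scalar_prod_distrib[of _ n])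
    also have "\<dots> > 0"
    proof (rule add_nonneg_pos)
      show "0 \<le> (S *\<^sub>v v) \<bullet>c v"
        using S v by (simp add: psd_mat_def)
      show "0 < complex_of_real s * (v \<bullet>c v)"
        using s v conjugate_square_greater_0_vec[OF v(1)]
        by (simp add: less_complex_def)
    qed
    finally show False by simp
  qed
  then have "J \<in> Units (ring_mat TYPE(complex) n ())"
    by (rule det_non_zero_imp_unit[OF J])
  then obtain C where C: "mat_inverse J = Some C"
    using mat_inverse(1)[OF J, where b = "()"] by (cases "mat_inverse J") auto
  then show "mat_inv J \<in> carrier_mat n n" "J * mat_inv J = 1\<^sub>m n" "mat_inv J * J = 1\<^sub>m n"
    using mat_inverse(2)[OF J C] by auto
qed

text \<open>Taking adjoints in A^-1 A = I shows that the adjoint of the inverse is a right inverse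
  of \<open>A\<close>, and inverses are unique.\<close>

lemma adjoint_mat_inv:
  assumes "A \<in> carrier_mat n n" "mat_inv A \<in> carrier_mat n n" "mat_inv A * A = 1\<^sub>m n"
    and "A\<^sup>H = A"
  shows "(mat_inv A)\<^sup>H = mat_inv A"
proof -
  have "A * (mat_inv A)\<^sup>H = (mat_inv A * A)\<^sup>H"
    using assms(1,2,4) by (subst adjoint_mult) auto
  also have "\<dots> = 1\<^sub>m n"
    using assms(3) by simp
  finally have "mat_inv A = (mat_inv A)\<^sup>H"
    using assms by (intro mat_inv_eqI) auto
  then show ?thesis by simp
qed

section \<open>Identities for the receiver and the error matrix\<close>

lemma receiver_times_weight:
  assumes F: "F \<in> carrier_mat n n" and G: "G \<in> carrier_mat n s"
    and Fi: "Fi \<in> carrier_mat n n" "F * Fi = 1\<^sub>m n"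
    and Ji: "Ji \<in> carrier_mat n n" "Ji * (F + G * G\<^sup>H) = 1\<^sub>m n"
  shows "Ji * G * (1\<^sub>m s + G\<^sup>H * Fi * G) = Fi * G"
proof -
  have "Ji * G * (1\<^sub>m s + G\<^sup>H * Fi * G) = Ji * (G + G * G\<^sup>H * (Fi * G))"
  proof -
    have "G * (1\<^sub>m s + G\<^sup>H * Fi * G) = G + G * (G\<^sup>H * Fi * G)"
      using G Fi by (subst mult_add_distrib_mat[of _ n s _ s]) auto
    then show ?thesis
      using G Fi Ji by (auto simp: mult_assoc_mat_dim simp del: assoc_mult_mat)
  qed
  \<comment> \<open>Writing the lone \<open>G\<close> as F F^-1 G exposes the common right factor
    F^-1 G; the remaining left factor is the one that \<open>Ji\<close> cancels.\<close>
  also have "G + G * G\<^sup>H * (Fi * G) = (F + G * G\<^sup>H) * (Fi * G)"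
  proof -
    have "F * (Fi * G) = G"
      using F Fi G by (subst assoc_mult_mat[symmetric]) auto
    then show ?thesis
      using F Fi G by (subst add_mult_distrib_mat[of _ n n]) auto
  qed
  also have "Ji * \<dots> = Ji * (F + G * G\<^sup>H) * (Fi * G)"
    using F G Fi Ji by (subst assoc_mult_mat) auto
  also have "\<dots> = Fi * G"
    using Ji Fi G by simp
  finally show ?thesis .
qed

text \<open>The quadratic term equals L^H (J L) = L^H G and cancels the first linear term.\<close>

lemma error_mat_eq:
  assumes J: "J \<in> carrier_mat n n" and G: "G \<in> carrier_mat n s"
    and L: "L \<in> carrier_mat n s" "J * L = G"
  shows "L\<^sup>H * J * L - L\<^sup>H * G - G\<^sup>H * L + 1\<^sub>m s = 1\<^sub>m s - G\<^sup>H * (L :: complex mat)"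
proof -
  have "L\<^sup>H * J * L = L\<^sup>H * G"
    using J L by (subst mult_assoc_mat_dim) auto
  then show ?thesis
    using G L by (intro eq_matI) auto
qed

section \<open>Comparison of one round of the two algorithms\<close>

theorem mainTheorem5:
  fixes K :: nat
    and Mt Mr Ms :: "nat \<Rightarrow> nat"
    and H :: "nat \<Rightarrow> nat \<Rightarrow> complex mat"
    and W0 :: "nat \<Rightarrow> complex mat"
    and \<sigma> \<omega> P :: "nat \<Rightarrow> real"
    and F L M A B :: "nat \<Rightarrow> complex mat"
    and V_WMMSE V_MM :: "nat \<Rightarrow> real \<Rightarrow> complex mat"
    and W_WMMSE W_MM :: "nat \<Rightarrow> complex mat"
  assumes H_dim: "\<And>i j. i \<in> {1..K} \<Longrightarrow> j \<in> {1..K} \<Longrightarrow> H i j \<in> carrier_mat (Mr i) (Mt j)"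
    and W0_dim: "\<And>k. k \<in> {1..K} \<Longrightarrow> W0 k \<in> carrier_mat (Mt k) (Ms k)"
    and noise: "\<And>k. k \<in> {1..K} \<Longrightarrow> (\<sigma> k)\<^sup>2 > 0"
    and weight: "\<And>k. k \<in> {1..K} \<Longrightarrow> \<omega> k > 0"
    and power: "\<And>k. k \<in> {1..K} \<Longrightarrow> P k > 0"
    and F_eq: "\<And>k. k \<in> {1..K} \<Longrightarrow> F k =
      finsum_mat (Mr k) (Mr k) (\<lambda>j. H k j * W0 j * (W0 j)\<^sup>H * (H k j)\<^sup>H) ({1..K} - {k})
      + complex_of_real ((\<sigma> k)\<^sup>2) \<cdot>\<^sub>m 1\<^sub>m (Mr k)"
    \<comment> \<open>one WMMSE round\<close>
    and L_eq: "\<And>k. k \<in> {1..K} \<Longrightarrow> L k =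
      mat_inv (F k + H k k * W0 k * (W0 k)\<^sup>H * (H k k)\<^sup>H) * H k k * W0 k"
    and M_eq: "\<And>k. k \<in> {1..K} \<Longrightarrow> M k = mat_inv (
      finsum_mat (Ms k) (Ms k)
        (\<lambda>j. (L k)\<^sup>H * H k j * W0 j * (W0 j)\<^sup>H * (H k j)\<^sup>H * L k) {1..K}
      - (L k)\<^sup>H * H k k * W0 k
      - (W0 k)\<^sup>H * (H k k)\<^sup>H * L k
      + complex_of_real ((\<sigma> k)\<^sup>2) \<cdot>\<^sub>m ((L k)\<^sup>H * L k)
      + 1\<^sub>m (Ms k))"
    and V_WMMSE_eq: "\<And>k \<mu>. k \<in> {1..K} \<Longrightarrow> V_WMMSE k \<mu> =
      pseudo_inverse (
        finsum_mat (Mt k) (Mt k)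
          (\<lambda>j. complex_of_real (\<omega> j) \<cdot>\<^sub>m ((H j k)\<^sup>H * L j * M j * (L j)\<^sup>H * H j k)) {1..K}
        + complex_of_real \<mu> \<cdot>\<^sub>m 1\<^sub>m (Mt k))
      * (complex_of_real (\<omega> k) \<cdot>\<^sub>m ((H k k)\<^sup>H * L k * M k))"
    and W_WMMSE_eq: "\<And>k. k \<in> {1..K} \<Longrightarrow>
      W_WMMSE k = V_WMMSE k (power_multiplier (V_WMMSE k) (P k))"
    \<comment> \<open>one WSR-MM round\<close>
    and B_eq: "\<And>k. k \<in> {1..K} \<Longrightarrow> B k = (W0 k)\<^sup>H * (H k k)\<^sup>H * mat_inv (F k)"
    and A_eq: "\<And>k. k \<in> {1..K} \<Longrightarrow> A k =
      mat_inv (F k + H k k * W0 k * (W0 k)\<^sup>H * (H k k)\<^sup>H) * H k k * W0 k * B k"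
    and V_MM_eq: "\<And>k \<mu>. k \<in> {1..K} \<Longrightarrow> V_MM k \<mu> =
      pseudo_inverse (
        finsum_mat (Mt k) (Mt k)
          (\<lambda>j. complex_of_real (\<omega> j) \<cdot>\<^sub>m ((H j k)\<^sup>H * A j * H j k)) {1..K}
        + complex_of_real \<mu> \<cdot>\<^sub>m 1\<^sub>m (Mt k))
      * (complex_of_real (\<omega> k) \<cdot>\<^sub>m ((H k k)\<^sup>H * (B k)\<^sup>H))"
    and W_MM_eq: "\<And>k. k \<in> {1..K} \<Longrightarrow>
      W_MM k = V_MM k (power_multiplier (V_MM k) (P k))"
  shows "\<forall>k\<in>{1..K}.
      M k = 1\<^sub>m (Ms k) + (W0 k)\<^sup>H * (H k k)\<^sup>H * mat_inv (F k) * H k k * W0 k \<and>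
      L k * M k * (L k)\<^sup>H = A k \<and>
      (M k)\<^sup>H * (L k)\<^sup>H = B k \<and>
      W_WMMSE k = W_MM k"
proof -
  \<comment> \<open>\<open>G k\<close> is the direct channel combined with its beamformer,
    \<open>X k j\<close> the covariance at receiver k of the signal from transmitter j,
    \<open>J k\<close> the total received covariance, and \<open>N k\<close> the value claimed for
    \<open>M k\<close>.\<close>
  define G where "G k = H k k * W0 k" for k
  define X where "X k j = H k j * W0 j * (W0 j)\<^sup>H * (H k j)\<^sup>H" for k j
  define J where "J k = F k + X k k" for k
  define N where "N k = 1\<^sub>m (Ms k) + (G k)\<^sup>H * mat_inv (F k) * G k" for k
  \<comment> \<open>The beamformer of one link involves \<open>L j\<close>, \<open>M j\<close> and
    \<open>A j\<close> of every link, so the identities and dimensions are established for all links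
    before any beamformer is compared.\<close>
  have key: "M k = 1\<^sub>m (Ms k) + (W0 k)\<^sup>H * (H k k)\<^sup>H * mat_inv (F k) * H k k * W0 k \<and>
      L k * M k = (B k)\<^sup>H \<and> (M k)\<^sup>H * (L k)\<^sup>H = B k \<and> L k * M k * (L k)\<^sup>H = A k \<and>
      L k \<in> carrier_mat (Mr k) (Ms k) \<and> M k \<in> carrier_mat (Ms k) (Ms k) \<and>
      A k \<in> carrier_mat (Mr k) (Mr k)"
    if k: "k \<in> {1..K}" for k
  proof -
    let ?n = "Mr k" and ?s = "Ms k"
    have HW: "H k j \<in> carrier_mat ?n (Mt j)" "W0 j \<in> carrier_mat (Mt j) (Ms j)"
      if "j \<in> {1..K}" for j
      using that k H_dim W0_dim by auto
    have G: "G k \<in> carrier_mat ?n ?s"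
      using HW[OF k] by (auto simp: G_def)
    have Gadj: "(G k)\<^sup>H = (W0 k)\<^sup>H * (H k k)\<^sup>H"
      using HW[OF k] by (auto simp: G_def adjoint_mult)
    have X_psd: "psd_mat ?n (X k j)" if "j \<in> {1..K}" for j
    proof -
      have "X k j = (H k j * W0 j) * (H k j * W0 j)\<^sup>H"
        using HW[OF that] by (auto simp: X_def adjoint_mult mult_assoc_mat_dim)
      then show ?thesis
        using HW[OF that] by (auto intro!: psd_mat_mult_adjoint[of _ _ "Ms j"])
    qed
    then have X: "X k j \<in> carrier_mat ?n ?n" if "j \<in> {1..K}" for j
      using that by (auto simp: psd_mat_def)
    have XG: "X k k = G k * (G k)\<^sup>H"
      using HW[OF k] Gadj by (auto simp: X_def G_def mult_assoc_mat_dim)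
    \<comment> \<open>\<open>S\<close> is the interference without noise. It gives
      \<open>F k\<close> and \<open>J k\<close> the common shape, positive semidefinite plus a
      positive multiple of the identity, that \<open>mat_inv_pos_def\<close> inverts.\<close>
    define S where "S = finsum_mat ?n ?n (X k) ({1..K} - {k})"
    have S_psd: "psd_mat ?n S"
      unfolding S_def using X_psd by (intro psd_mat_finsum) auto
    then have S: "S \<in> carrier_mat ?n ?n"
      by (simp add: psd_mat_def)
    have F_S: "F k = S + complex_of_real ((\<sigma> k)\<^sup>2) \<cdot>\<^sub>m 1\<^sub>m ?n"
      using F_eq[OF k] by (simp add: S_def X_def[abs_def])
    have SX_psd: "psd_mat ?n (X k k + S)"
      using X_psd[OF k] S_psd by (rule psd_mat_add)
    \<comment> \<open>The order \<open>X k k + S\<close> is the one in which splitting off link k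
      from the sum over all links presents that sum below.\<close>
    have J_S: "J k = (X k k + S) + complex_of_real ((\<sigma> k)\<^sup>2) \<cdot>\<^sub>m 1\<^sub>m ?n"
      using S X[OF k] by (intro eq_matI) (auto simp: J_def F_S)
    note F_inv = mat_inv_pos_def[OF S_psd noise[OF k], folded F_S]
    note J_inv = mat_inv_pos_def[OF SX_psd noise[OF k], folded J_S]
    have F: "F k \<in> carrier_mat ?n ?n" and J: "J k \<in> carrier_mat ?n ?n"
      using S X[OF k] by (auto simp: F_S J_def)
    \<comment> \<open>The noise coefficient is real, so \<open>F k\<close> is Hermitian. Its inverse
      is then Hermitian too, which later turns B^H into F^-1 G.\<close>
    have "(F k)\<^sup>H = F k"
      using S S_psd by (auto simp: F_S psd_mat_def adjoint_add[of _ ?n ?n] adjoint_smult)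
    then have Fi_adj: "(mat_inv (F k))\<^sup>H = mat_inv (F k)"
      using F F_inv by (intro adjoint_mat_inv) auto
    have L_G: "L k = mat_inv (J k) * G k"
      using L_eq[OF k] J_inv(1) HW[OF k]
      by (auto simp: J_def X_def G_def mult_assoc_mat_dim)
    have L: "L k \<in> carrier_mat ?n ?s"
      using L_G J_inv G by auto
    have JL: "J k * L k = G k"
      using L_G J J_inv G by (simp flip: assoc_mult_mat)
    have N: "N k \<in> carrier_mat ?s ?s"
      using G F_inv by (auto simp: N_def)
    have LN: "L k * N k = mat_inv (F k) * G k"
      unfolding L_G N_def
      by (rule receiver_times_weight[OF F G F_inv(1,2) J_inv(1)])
        (use J_inv(3) in \<open>simp add: J_def XG\<close>)
    have SX: "finsum_mat ?n ?n (X k) {1..K} = X k k + S"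
    proof -
      have "{1..K} = insert k ({1..K} - {k})"
        using k by auto
      moreover have "finsum_mat ?n ?n (X k) (insert k ({1..K} - {k})) = X k k + S"
        unfolding S_def using X k by (intro finsum_mat_insert) auto
      ultimately show ?thesis by simp
    qed
    have sum_L: "finsum_mat ?s ?s
        (\<lambda>j. (L k)\<^sup>H * H k j * W0 j * (W0 j)\<^sup>H * (H k j)\<^sup>H * L k) {1..K}
        = (L k)\<^sup>H * (X k k + S) * L k"
    proof -
      have "finsum_mat ?s ?s
          (\<lambda>j. (L k)\<^sup>H * H k j * W0 j * (W0 j)\<^sup>H * (H k j)\<^sup>H * L k) {1..K}
          = finsum_mat ?s ?s (\<lambda>j. (L k)\<^sup>H * X k j * L k) {1..K}"
      proof (rule finsum_mat_cong)
        fix j assume j: "j \<in> {1..K}"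
        show "(L k)\<^sup>H * H k j * W0 j * (W0 j)\<^sup>H * (H k j)\<^sup>H * L k = (L k)\<^sup>H * X k j * L k"
          using HW[OF j] L by (auto simp: X_def mult_assoc_mat_dim)
        show "(L k)\<^sup>H * X k j * L k \<in> carrier_mat ?s ?s"
          using X[OF j] L by auto
      qed
      also have "\<dots> = (L k)\<^sup>H * (X k k + S) * L k"
        unfolding SX[symmetric] using X L by (intro finsum_mat_sandwich) auto
      finally show ?thesis .
    qed
    \<comment> \<open>The noise term of the error matrix completes the quadratic form of the signal
      covariance to that of \<open>J k\<close>.\<close>
    have LJL: "(L k)\<^sup>H * J k * L k
        = (L k)\<^sup>H * (X k k + S) * L k + complex_of_real ((\<sigma> k)\<^sup>2) \<cdot>\<^sub>m ((L k)\<^sup>H * L k)"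
    proof -
      have "(L k)\<^sup>H * J k
          = (L k)\<^sup>H * (X k k + S) + complex_of_real ((\<sigma> k)\<^sup>2) \<cdot>\<^sub>m (L k)\<^sup>H"
        unfolding J_S using S X[OF k] L
        by (subst mult_add_distrib_mat[of _ ?s ?n _ ?n])
          (auto simp: mult_smult_distrib[of _ ?s ?n _ ?n] simp del: of_real_power)
      then show ?thesis
        using S X[OF k] L
        by (simp add: add_mult_distrib_mat[of _ ?s ?n _ _ ?s] mult_smult_assoc_mat[of _ ?s ?n _ ?s]
            del: of_real_power assoc_mult_mat)
    qed
    have "finsum_mat ?s ?s
        (\<lambda>j. (L k)\<^sup>H * H k j * W0 j * (W0 j)\<^sup>H * (H k j)\<^sup>H * L k) {1..K}
      - (L k)\<^sup>H * H k k * W0 k - (W0 k)\<^sup>H * (H k k)\<^sup>H * L k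
      + complex_of_real ((\<sigma> k)\<^sup>2) \<cdot>\<^sub>m ((L k)\<^sup>H * L k) + 1\<^sub>m ?s
      = (L k)\<^sup>H * J k * L k - (L k)\<^sup>H * G k - (G k)\<^sup>H * L k + 1\<^sub>m ?s"
    proof -
      have "(L k)\<^sup>H * H k k * W0 k = (L k)\<^sup>H * G k"
        using HW[OF k] L by (auto simp: G_def mult_assoc_mat_dim)
      moreover have "(L k)\<^sup>H * (X k k + S) * L k \<in> carrier_mat ?s ?s"
        "(L k)\<^sup>H * G k \<in> carrier_mat ?s ?s" "(G k)\<^sup>H * L k \<in> carrier_mat ?s ?s"
        "(L k)\<^sup>H * L k \<in> carrier_mat ?s ?s"
        using L G S X[OF k] by auto
      \<comment> \<open>In the formula for \<open>M k\<close> the noise term comes after both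
        subtractions; it has to move next to the quadratic term before \<open>LJL\<close> can absorb
        the pair.\<close>
      moreover have "P - Q - R + T = P + T - Q - R"
        if "P \<in> carrier_mat ?s ?s" "Q \<in> carrier_mat ?s ?s" "R \<in> carrier_mat ?s ?s"
          "T \<in> carrier_mat ?s ?s" for P Q R T :: "complex mat"
        using that by (intro eq_matI) auto
      ultimately show ?thesis
        unfolding sum_L LJL Gadj[symmetric] by simp
    qed
    also have "\<dots> = 1\<^sub>m ?s - (G k)\<^sup>H * L k"
      using J G L JL by (rule error_mat_eq)
    finally have M_inv: "M k = mat_inv (1\<^sub>m ?s - (G k)\<^sup>H * L k)"
      using M_eq[OF k] by simp
    have "(1\<^sub>m ?s - (G k)\<^sup>H * L k) * N k = N k - (G k)\<^sup>H * (L k * N k)"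
      using G L N by (subst minus_mult_distrib_mat[of _ ?s ?s]) auto
    also have "\<dots> = 1\<^sub>m ?s"
      unfolding LN using G F_inv by (intro eq_matI) (auto simp: N_def mult_assoc_mat_dim)
    \<comment> \<open>The right inverse just found fixes the value of \<open>mat_inv\<close> through
      \<open>mat_inv_eqI\<close>, so invertibility of the error matrix calls for no separate
      argument.\<close>
    finally have M: "M k = N k"
      unfolding M_inv using G L N by (intro mat_inv_eqI) auto
    have B: "B k = (G k)\<^sup>H * mat_inv (F k)"
      using B_eq[OF k] Gadj by simp
    have B_adj: "(B k)\<^sup>H = mat_inv (F k) * G k"
      unfolding B using G F_inv Fi_adj by (auto simp: adjoint_mult)
    then have LM: "L k * M k = (B k)\<^sup>H"
      using LN M by simp
    have MB: "(M k)\<^sup>H * (L k)\<^sup>H = B k"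
      using LM L M N by (metis adjoint_adjoint adjoint_mult carrier_matD)
    \<comment> \<open>Since M = N is Hermitian, M^H L^H = B also reads M L^H = B. Hence L M L^H = L
      B, and the factor of \<open>A k\<close> in front of \<open>B k\<close> is \<open>L k\<close>
      itself.\<close>
    have "(N k)\<^sup>H = N k"
      using G F_inv Fi_adj
      by (auto simp: N_def adjoint_add[of _ ?s ?s] adjoint_mult mult_assoc_mat_dim)
    then have "L k * M k * (L k)\<^sup>H = L k * B k"
      using L M N MB by (subst mult_assoc_mat_dim) auto
    moreover have "A k = L k * B k"
      using A_eq[OF k] L_eq[OF k] by simp
    moreover have "L k * B k \<in> carrier_mat ?n ?n"
      using L B G F_inv by auto
    moreover have "M k = 1\<^sub>m ?s + (W0 k)\<^sup>H * (H k k)\<^sup>H * mat_inv (F k) * H k k * W0 k"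
      using HW[OF k] F_inv(1) unfolding M N_def Gadj by (auto simp: G_def mult_assoc_mat_dim)
    moreover have "M k \<in> carrier_mat ?s ?s"
      using M N by simp
    ultimately show ?thesis
      using LM MB L by metis
  qed
  then have dims: "L k \<in> carrier_mat (Mr k) (Ms k)" "M k \<in> carrier_mat (Ms k) (Ms k)"
      "A k \<in> carrier_mat (Mr k) (Mr k)"
    if "k \<in> {1..K}" for k
    using that by blast+
  \<comment> \<open>Equality is needed as functions, because \<open>power_multiplier\<close> takes
    the whole function of the multiplier as its argument. Equal functions then give the same
    multiplier, even if the minimum is unspecified, and the same pseudo-inverse.\<close>
  have "V_WMMSE k = V_MM k" if k: "k \<in> {1..K}" for k
  proof
    fix \<mu>
    have "finsum_mat (Mt k) (Mt k)
          (\<lambda>j. complex_of_real (\<omega> j) \<cdot>\<^sub>m ((H j k)\<^sup>H * L j * M j * (L j)\<^sup>H * H j k)) {1..K}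
        = finsum_mat (Mt k) (Mt k)
          (\<lambda>j. complex_of_real (\<omega> j) \<cdot>\<^sub>m ((H j k)\<^sup>H * A j * H j k)) {1..K}"
    proof (rule finsum_mat_cong)
      fix j assume j: "j \<in> {1..K}"
      have LML: "L j * M j * (L j)\<^sup>H = A j"
        using key[OF j] by blast
      \<comment> \<open>Rebracketing makes L M L^H a literal subterm, which can then be replaced by
        \<open>A j\<close>.\<close>
      have "(H j k)\<^sup>H * L j * M j * (L j)\<^sup>H = (H j k)\<^sup>H * (L j * M j * (L j)\<^sup>H)"
        using dims[OF j] H_dim[OF j k] by (auto simp: mult_assoc_mat_dim)
      then show "complex_of_real (\<omega> j) \<cdot>\<^sub>m ((H j k)\<^sup>H * L j * M j * (L j)\<^sup>H * H j k)
          = complex_of_real (\<omega> j) \<cdot>\<^sub>m ((H j k)\<^sup>H * A j * H j k)"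
        unfolding LML by simp
      show "complex_of_real (\<omega> j) \<cdot>\<^sub>m ((H j k)\<^sup>H * A j * H j k) \<in> carrier_mat (Mt k) (Mt k)"
        using dims[OF j] H_dim[OF j k] by auto
    qed
    moreover have "(H k k)\<^sup>H * L k * M k = (H k k)\<^sup>H * (L k * M k)"
      using dims[OF k] H_dim[OF k k] by (auto simp: mult_assoc_mat_dim)
    then have "(H k k)\<^sup>H * L k * M k = (H k k)\<^sup>H * (B k)\<^sup>H"
      using key[OF k] by metis
    ultimately show "V_WMMSE k \<mu> = V_MM k \<mu>"
      using V_WMMSE_eq[OF k] V_MM_eq[OF k] by simp
  qed
  then have "W_WMMSE k = W_MM k" if "k \<in> {1..K}" for k
    using W_WMMSE_eq W_MM_eq that by metis
  then show ?thesis
    using key by blast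
qed

end
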